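(* Let $n,s,k$ be integers with $k\ge 1$ and $k+1\le s\le n$. Then $$p^1_{n;\le s;k}=\sum_{i=1}^{s-k-1}\binom{n-1}{s-i-k-1}\,p_{n+k-s+i;\le i}\;p^1_{s-k-i,\,s-i-1;\le s-i-1}.$$
   Context: Parking model: there are $m$ parking spaces in a line, numbered $1,\dots,m$. A preference set of length $n$ is a sequence $(a_1,\dots,a_n)$ of integers with $1\le a_i\le m$; cars $1,\dots,n$ arrive in order, car $i$ parks in the first unoccupied space numbered $\ge a_i$ if one exists, otherwise it fails to park. A $k$-flaw preference set is one in which exactly $k$ cars fail to park; a $0$-flaw one is a parking function. $p_{n,m;\le s;k}$ is the number of $k$-flaw preference sets of length $n$ with $m$ spaces and all $a_i\le s$, and $p^l_{n,m;\le s;k}$ the number of those with $a_1=l$. Conventions: omitted $k$ means $k=0$; omitted $m$ means $m=n$. Thus $p^1_{n;\le s;k}$ counts $k$-flaw preference sets with $n$ cars, $n$ spaces, entries $\le s$ and $a_1=1$; $p_{j;\le i}$ counts parking functions of length $j$ with $j$ spaces and entries $\le i$; $p^1_{j,m;\le t}$ counts parking functions of length $j$ with $m$ spaces, entries $\le t$ and first entry $1$. *)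

theory Defs
  imports Complex_Main
begin

definition preference_sets :: "nat \<Rightarrow> nat \<Rightarrow> nat list set" where
  "preference_sets n m = {as. length as = n \<and> (\<forall>a \<in> set as. 1 \<le> a \<and> a \<le> m)}"

definition parking_space :: "nat \<Rightarrow> nat set \<Rightarrow> nat \<Rightarrow> nat option" where
  "parking_space m occ a =
    (if \<exists>j. a \<le> j \<and> j \<le> m \<and> j \<notin> occ
     then Some (LEAST j. a \<le> j \<and> j \<le> m \<and> j \<notin> occ) else None)"

text \<open>The number of cars that fail to park when cars with the given preferences arrive in
  order and the spaces in the set argument are already occupied.\<close>

fun failures :: "nat \<Rightarrow> nat set \<Rightarrow> nat list \<Rightarrow> nat" where
  "failures m occ [] = 0"
| "failures m occ (a # as) =
    (case parking_space m occ a of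
       None \<Rightarrow> Suc (failures m occ as)
     | Some j \<Rightarrow> failures m (insert j occ) as)"

definition flaw_sets :: "nat \<Rightarrow> nat \<Rightarrow> nat \<Rightarrow> nat \<Rightarrow> nat list set" where
  "flaw_sets n m s k =
    {as \<in> preference_sets n m. (\<forall>a \<in> set as. a \<le> s) \<and> failures m {} as = k}"

text \<open>\<open>flaw_count n m s k\<close> is $p_{n,m;\le s;k}$ and
  \<open>flaw_count_first l n m s k\<close> is $p^l_{n,m;\le s;k}$. An omitted $m$ is $n$ and an
  omitted $k$ is $0$.\<close>

definition flaw_count :: "nat \<Rightarrow> nat \<Rightarrow> nat \<Rightarrow> nat \<Rightarrow> nat" where
  "flaw_count n m s k = card (flaw_sets n m s k)"

definition flaw_count_first :: "nat \<Rightarrow> nat \<Rightarrow> nat \<Rightarrow> nat \<Rightarrow> nat \<Rightarrow> nat" where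
  "flaw_count_first l n m s k = card {as \<in> flaw_sets n m s k. as \<noteq> [] \<and> hd as = l}"

end

theory Submission
  imports Defs
begin

text \<open>
  If \<open>k \<ge> 1\<close> cars fail then \<open>k\<close> of the \<open>n\<close> spaces stay empty; let \<open>e = s - i\<close> be the last one. No
  car prefers \<open>e\<close>, the cars preferring a space before \<open>e\<close> all park before \<open>e\<close>, and the cars
  preferring a space after \<open>e\<close> fill all \<open>n - e\<close> spaces there and account for all \<open>k\<close> failures. So
  there are \<open>n - e + k\<close> cars on the right and \<open>e - k\<close> on the left, the first car being a left one,
  and the preference set is an arbitrary shuffle of the two sides. As the right preferences are
  at most \<open>s - e \<le> n - e\<close> after shifting, filling the \<open>n - e\<close> spaces is the same as being a parking
  function with \<open>n - e + k\<close> spaces.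
\<close>

section \<open>Parking one car at a time, and the spaces taken in the end\<close>

fun occupied :: "nat \<Rightarrow> nat set \<Rightarrow> nat list \<Rightarrow> nat set" where
  "occupied m occ [] = occ"
| "occupied m occ (a # as) =
    (case parking_space m occ a of
       None \<Rightarrow> occupied m occ as
     | Some j \<Rightarrow> occupied m (insert j occ) as)"

lemma parking_space_eq_None_iff:
  "parking_space m occ a = None \<longleftrightarrow> (\<forall>j. a \<le> j \<and> j \<le> m \<longrightarrow> j \<in> occ)"
  unfolding parking_space_def by auto

lemma parking_space_eq_Some_iff:
  "parking_space m occ a = Some j \<longleftrightarrow>
     a \<le> j \<and> j \<le> m \<and> j \<notin> occ \<and> (\<forall>i. a \<le> i \<and> i < j \<longrightarrow> i \<in> occ)"
proof
  assume "parking_space m occ a = Some j"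
  then have ex: "\<exists>j. a \<le> j \<and> j \<le> m \<and> j \<notin> occ"
    and j: "j = (LEAST j. a \<le> j \<and> j \<le> m \<and> j \<notin> occ)"
    unfolding parking_space_def by (auto split: if_splits)
  have j': "a \<le> j \<and> j \<le> m \<and> j \<notin> occ"
    unfolding j using ex by (rule LeastI_ex)
  moreover have "i \<in> occ" if "a \<le> i" "i < j" for i
    using not_less_Least[of i "\<lambda>j. a \<le> j \<and> j \<le> m \<and> j \<notin> occ"] that j j' by auto
  ultimately show "a \<le> j \<and> j \<le> m \<and> j \<notin> occ \<and> (\<forall>i. a \<le> i \<and> i < j \<longrightarrow> i \<in> occ)"
    by blast
next
  assume *: "a \<le> j \<and> j \<le> m \<and> j \<notin> occ \<and> (\<forall>i. a \<le> i \<and> i < j \<longrightarrow> i \<in> occ)"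
  then have "(LEAST j. a \<le> j \<and> j \<le> m \<and> j \<notin> occ) = j"
    by (intro Least_equality) (auto simp: not_less[symmetric])
  with * show "parking_space m occ a = Some j"
    unfolding parking_space_def by auto
qed

lemma occupied_mono: "occ \<subseteq> occupied m occ as"
  by (induction m occ as rule: occupied.induct) (auto split: option.splits)

text \<open>Each car either fails or takes one new space. This balance turns statements about
  failures into statements about cardinalities and back.\<close>

lemma failures_plus_card_occupied:
  "finite occ \<Longrightarrow> failures m occ as + card (occupied m occ as) = length as + card occ"
proof (induction as arbitrary: occ)
  case (Cons a as)
  show ?case
  proof (cases "parking_space m occ a")
    case None
    with Cons show ?thesis by simp
  next
    case (Some j)
    then have "j \<notin> occ" by (simp add: parking_space_eq_Some_iff)
    with Some Cons.IH[of "insert j occ"] Cons.prems show ?thesis by simp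
  qed
qed simp

lemma occupied_subset:
  "occ \<subseteq> {1..m} \<Longrightarrow> \<forall>a\<in>set as. 1 \<le> a \<Longrightarrow> occupied m occ as \<subseteq> {1..m}"
proof (induction as arbitrary: occ)
  case (Cons a as)
  show ?case
  proof (cases "parking_space m occ a")
    case None
    with Cons show ?thesis by simp
  next
    case (Some j)
    with Cons.prems have "insert j occ \<subseteq> {1..m}"
      by (auto simp: parking_space_eq_Some_iff)
    with Cons Some show ?thesis by simp
  qed
qed simp

section \<open>Cutting the line of spaces\<close>

text \<open>What happens beyond \<open>N\<close> never influences the first \<open>N\<close> spaces:
  a car that parks beyond \<open>N\<close> in the long line merely fails in the short one.\<close>

lemma occupied_truncate:
  assumes "N \<le> M"
  shows "occupied N (occ \<inter> {..N}) as = occupied M occ as \<inter> {..N}"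
proof (induction as arbitrary: occ)
  case (Cons a as)
  show ?case
  proof (cases "parking_space M occ a")
    case None
    then have "parking_space N (occ \<inter> {..N}) a = None"
      using assms by (auto simp: parking_space_eq_None_iff)
    with None Cons show ?thesis by simp
  next
    case (Some j)
    show ?thesis
    proof (cases "j \<le> N")
      case True
      then have "parking_space N (occ \<inter> {..N}) a = Some j"
        using Some by (auto simp: parking_space_eq_Some_iff)
      with Some True Cons[of "insert j occ"] show ?thesis by simp
    next
      case False
      then have "parking_space N (occ \<inter> {..N}) a = None"
        using Some by (auto simp: parking_space_eq_Some_iff parking_space_eq_None_iff)
      with Some False Cons[of "insert j occ"] show ?thesis by simp
    qed
  qed
qed simp

text \<open>Such a car cannot pass the free space \<open>e\<close>, so a failure in the line of
  \<open>e - 1\<close> spaces becomes an overflow into \<open>e\<close>.\<close>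

lemma parking_space_left_of_empty:
  assumes "e \<le> m" "e \<notin> occ" "a < e"
  shows "parking_space m occ a =
    (case parking_space (e - 1) (occ \<inter> {..<e}) a of None \<Rightarrow> Some e | Some j \<Rightarrow> Some j)"
  using assms
  by (auto simp: parking_space_eq_Some_iff parking_space_eq_None_iff split: option.split)

text \<open>The spaces after \<open>e\<close> are renumbered from 1, which is why
  \<open>1 \<le> x\<close> appears: \<open>x = 0\<close> would stand for \<open>e\<close>
  itself.\<close>

lemma parking_space_right_of_empty:
  assumes "e < a"
  shows "parking_space m occ a =
    map_option (\<lambda>j. j + e) (parking_space (m - e) {x. 1 \<le> x \<and> x + e \<in> occ} (a - e))"
proof (cases "parking_space (m - e) {x. 1 \<le> x \<and> x + e \<in> occ} (a - e)")
  case None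
  have "j \<in> occ" if "a \<le> j" "j \<le> m" for j
  proof -
    have "a - e \<le> j - e \<and> j - e \<le> m - e" using that by auto
    with None have "j - e + e \<in> occ" by (auto simp: parking_space_eq_None_iff)
    with that assms show ?thesis by simp
  qed
  then have "parking_space m occ a = None" by (auto simp: parking_space_eq_None_iff)
  with None show ?thesis by simp
next
  case (Some j)
  have "i \<in> occ" if "a \<le> i" "i < j + e" for i
  proof -
    have "a - e \<le> i - e \<and> i - e < j" using that assms by auto
    with Some have "i - e + e \<in> occ" by (auto simp: parking_space_eq_Some_iff)
    with that assms show ?thesis by simp
  qed
  then have "parking_space m occ a = Some (j + e)"
    using Some assms by (auto simp: parking_space_eq_Some_iff)
  with Some show ?thesis by simp
qed

text \<open>No car crosses a space that stays empty, so the two sides evolve independently. The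
  space \<open>e\<close> is lost only to a car that prefers it or to a left car that overflows. An
  arbitrary \<open>occ\<close> with \<open>e\<close> free is what the induction over arriving cars
  requires.\<close>

lemma empty_space_splits:
  assumes "e \<le> m" "e \<notin> occ"
  shows "(e \<notin> occupied m occ as \<longleftrightarrow>
           e \<notin> set as \<and> failures (e - 1) (occ \<inter> {..<e}) (filter (\<lambda>a. a < e) as) = 0) \<and>
         (e \<notin> occupied m occ as \<longrightarrow>
           failures m occ as = failures (m - e) {x. 1 \<le> x \<and> x + e \<in> occ}
             (map (\<lambda>a. a - e) (filter (\<lambda>a. e < a) as)) \<and>
           {x. 1 \<le> x \<and> x + e \<in> occupied m occ as} =
             occupied (m - e) {x. 1 \<le> x \<and> x + e \<in> occ}
               (map (\<lambda>a. a - e) (filter (\<lambda>a. e < a) as)))"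
  using assms(2)
proof (induction as arbitrary: occ)
  case (Cons a as)
  consider "a < e" | "a = e" | "e < a" by linarith
  then show ?case
  proof cases
    case 1
    note sp = parking_space_left_of_empty[OF assms(1) Cons.prems 1]
    show ?thesis
    proof (cases "parking_space (e - 1) (occ \<inter> {..<e}) a")
      case None
      \<comment> \<open>The car overflows into \<open>e\<close>, which stays taken from then on,
        while the line of \<open>e - 1\<close> spaces records a failure: both sides of the
        equivalence are false.\<close>
      have "e \<in> occupied m (insert e occ) as" using occupied_mono by blast
      with None sp 1 show ?thesis by simp
    next
      case (Some j)
      then have "j < e" using 1 by (auto simp: parking_space_eq_Some_iff)
      then have "insert j occ \<inter> {..<e} = insert j (occ \<inter> {..<e})"
        "{x. 1 \<le> x \<and> x + e \<in> insert j occ} = {x. 1 \<le> x \<and> x + e \<in> occ}" by auto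
      with Cons.IH[of "insert j occ"] \<open>j < e\<close> Cons.prems Some sp 1 show ?thesis
        by simp
    qed
  next
    case 2
    have "parking_space m occ a = Some e"
      using 2 assms Cons.prems by (auto simp: parking_space_eq_Some_iff)
    moreover have "e \<in> occupied m (insert e occ) as" using occupied_mono by blast
    ultimately show ?thesis using 2 by simp
  next
    case 3
    note sp = parking_space_right_of_empty[OF 3, of m occ]
    show ?thesis
    proof (cases "parking_space (m - e) {x. 1 \<le> x \<and> x + e \<in> occ} (a - e)")
      case None
      with Cons sp 3 show ?thesis by simp
    next
      case (Some j)
      then have "1 \<le> j" using 3 by (auto simp: parking_space_eq_Some_iff)
      then have "insert (j + e) occ \<inter> {..<e} = occ \<inter> {..<e}"
        "{x. 1 \<le> x \<and> x + e \<in> insert (j + e) occ} = insert j {x. 1 \<le> x \<and> x + e \<in> occ}" by auto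
      with Cons.IH[of "insert (j + e) occ"] \<open>1 \<le> j\<close> Cons.prems Some sp 3 show ?thesis
        by simp
    qed
  qed
qed simp

section \<open>Filling a segment and parking functions\<close>

text \<open>If all \<open>N + k\<close> cars park in \<open>N + k\<close> spaces, every space is
  taken, in particular the first \<open>N\<close>. Conversely, a space left empty in the longer line
  would lie beyond \<open>N\<close>, and all cars would have to fit in front of it, where there is
  too little room.\<close>

lemma fills_iff_parking_function:
  assumes "length as = N + k" "\<forall>a\<in>set as. 1 \<le> a \<and> a \<le> N"
  shows "occupied N {} as = {1..N} \<longleftrightarrow> failures (N + k) {} as = 0"
proof
  have sub: "occupied (N + k) {} as \<subseteq> {1..N + k}"
    using assms by (intro occupied_subset) auto
  have bal: "failures (N + k) {} as + card (occupied (N + k) {} as) = N + k"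
    using failures_plus_card_occupied[of "{}" "N + k" as] assms by simp
  have trunc: "occupied N {} as = occupied (N + k) {} as \<inter> {..N}"
    using occupied_truncate[of N "N + k" "{}" as] by simp
  {
    assume "failures (N + k) {} as = 0"
    then have "occupied (N + k) {} as = {1..N + k}"
      using sub bal by (intro card_subset_eq) auto
    then show "occupied N {} as = {1..N}" using trunc by auto
  next
    assume full: "occupied N {} as = {1..N}"
    have "e \<in> occupied (N + k) {} as" if "e \<in> {1..N + k}" for e
    proof (rule ccontr)
      assume e: "e \<notin> occupied (N + k) {} as"
      have "N < e"
      proof (rule ccontr)
        assume "\<not> N < e"
        then have "e \<in> occupied N {} as" using full that by auto
        with e trunc show False by auto
      qed
      \<comment> \<open>All preferences are at most \<open>N < e\<close>, so every car counts as a
        left car for \<open>e\<close>.\<close>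
      then have "filter (\<lambda>a. a < e) as = as" using assms by (auto simp: filter_id_conv)
      then have "failures (e - 1) {} as = 0"
        using empty_space_splits[of e "N + k" "{}" as] e that by simp
      then have "card (occupied (e - 1) {} as) = N + k"
        using failures_plus_card_occupied[of "{}" "e - 1" as] assms by simp
      moreover have "occupied (e - 1) {} as \<subseteq> {1..e - 1}"
        using assms by (intro occupied_subset) auto
      then have "card (occupied (e - 1) {} as) \<le> e - 1"
        using card_mono[of "{1..e - 1}"] by fastforce
      ultimately show False using that by auto
    qed
    then have "occupied (N + k) {} as = {1..N + k}" using sub by blast
    then show "failures (N + k) {} as = 0" using bal by simp
  }
qed

section \<open>The last empty space and its two sides\<close>

definition last_empty :: "nat \<Rightarrow> nat list \<Rightarrow> nat \<Rightarrow> bool" where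
  "last_empty n as e \<longleftrightarrow>
     e \<in> {1..n} \<and> e \<notin> occupied n {} as \<and> (\<forall>x\<in>{e<..n}. x \<in> occupied n {} as)"

lemma last_empty_unique: "last_empty n as e \<Longrightarrow> last_empty n as e' \<Longrightarrow> e = e'"
  unfolding last_empty_def by (metis atLeastAtMost_iff greaterThanAtMost_iff nat_neq_iff)

text \<open>A failure means that fewer than \<open>n\<close> cars park, so some of the
  \<open>n\<close> spaces stays empty; the largest of these is the witness.\<close>

lemma ex_last_empty:
  assumes "length as = n" "\<forall>a\<in>set as. 1 \<le> a" "failures n {} as \<noteq> 0"
  shows "\<exists>e. last_empty n as e"
proof -
  define E where "E = {1..n} - occupied n {} as"
  have "card (occupied n {} as) < n"
    using failures_plus_card_occupied[of "{}" n as] assms by simp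
  then have "occupied n {} as \<noteq> {1..n}" by auto
  moreover have "occupied n {} as \<subseteq> {1..n}"
    using assms by (intro occupied_subset) auto
  ultimately have "E \<noteq> {}" unfolding E_def by auto
  moreover have "finite E" unfolding E_def by simp
  ultimately have "Max E \<in> E" and "\<forall>x\<in>E. x \<le> Max E" by auto
  moreover have "x \<in> occupied n {} as" if "x \<in> {Max E<..n}" for x
  proof (rule ccontr)
    assume "x \<notin> occupied n {} as"
    with that have "x \<in> E" by (simp add: E_def)
    with \<open>\<forall>x\<in>E. x \<le> Max E\<close> that show False by force
  qed
  moreover have "x \<in> {1..n} \<and> x \<notin> occupied n {} as" if "x \<in> E" for x
    using that by (simp add: E_def)
  ultimately have "last_empty n as (Max E)" unfolding last_empty_def by blast
  then show ?thesis ..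
qed

text \<open>All spaces after \<open>e\<close> are filled and all failures happen there, which fixes
  the two lengths by the balance of cars and spaces. \<open>R\<close> is the complement of
  \<open>L\<close>, so that the two filters partition the list; that no car prefers \<open>e\<close>
  is then encoded in \<open>R\<close> being a shift by \<open>e\<close> of positive entries.\<close>

lemma last_empty_flaw_iff:
  fixes n s k e :: nat and as :: "nat list"
  assumes "k \<ge> 1" "s \<le> n"
  defines "L \<equiv> filter (\<lambda>a. a < e) as" and "R \<equiv> filter (\<lambda>a. \<not> a < e) as"
  shows "as \<in> flaw_sets n n s k \<and> last_empty n as e \<longleftrightarrow>
    k \<le> e \<and> e < s \<and> L \<in> flaw_sets (e - k) (e - 1) (e - 1) 0 \<and>
    R \<in> map (\<lambda>a. a + e) ` flaw_sets (n + k - e) (n + k - e) (s - e) 0"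
proof
  define R' where "R' = map (\<lambda>a. a - e) (filter (\<lambda>a. e < a) as)"
  have len: "length L + length R = length as"
    unfolding L_def R_def by (rule sum_length_filter_compl)
  have R_eq: "R = map (\<lambda>a. a + e) R'" if "e \<notin> set as"
  proof -
    have "R = filter (\<lambda>a. e < a) as"
      unfolding R_def using that by (intro filter_cong) (auto simp: not_less le_less)
    moreover have "map (\<lambda>a. a + e) R' = map (\<lambda>a. a) (filter (\<lambda>a. e < a) as)"
      unfolding R'_def map_map by (intro map_cong) auto
    ultimately show ?thesis by simp
  qed
  note split = empty_space_splits[of e n "{}" as, folded L_def R'_def, simplified, folded R'_def]
  {
    assume "as \<in> flaw_sets n n s k \<and> last_empty n as e"
    then have as: "length as = n" "\<forall>a\<in>set as. 1 \<le> a \<and> a \<le> s" "failures n {} as = k"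
      and e: "e \<in> {1..n}" "e \<notin> occupied n {} as" "\<forall>x\<in>{e<..n}. x \<in> occupied n {} as"
      by (auto simp: flaw_sets_def preference_sets_def last_empty_def)
    have e': "e \<notin> set as" "failures (e - 1) {} L = 0" "failures (n - e) {} R' = k"
      "{x. 1 \<le> x \<and> x + e \<in> occupied n {} as} = occupied (n - e) {} R'"
      using split e as by auto
    have R'_range: "\<forall>a\<in>set R'. 1 \<le> a \<and> a \<le> s - e"
      using as by (auto simp: R'_def)
    have "occupied n {} as \<subseteq> {1..n}"
      using as by (intro occupied_subset) auto
    then have full: "occupied (n - e) {} R' = {1..n - e}"
      using e e'(4)[symmetric] by force
    then have lenR': "length R' = n - e + k"
      using failures_plus_card_occupied[of "{}" "n - e" R'] e' by simp
    \<comment> \<open>Since \<open>k \<ge> 1\<close>, there is a right car even if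
      \<open>e = n\<close>; its preference lies beyond \<open>e\<close> and is at most
      \<open>s\<close>, which forces \<open>e < s\<close>.\<close>
    then have "R' \<noteq> []" using assms by auto
    then have "e < s" using R'_range by (cases R') auto
    have lenL: "length L + (n - e + k) = n"
      using len lenR' R_eq[OF e'(1)] as by simp
    then have "k \<le> e" "length L = e - k" using e by auto
    moreover have "L \<in> flaw_sets (e - k) (e - 1) (e - 1) 0"
      using e' as \<open>length L = e - k\<close>
      by (auto simp: flaw_sets_def preference_sets_def L_def)
    \<comment> \<open>By \<open>s \<le> n\<close>, the shifted preferences are at most
      \<open>n - e\<close>, as the filling criterion demands.\<close>
    moreover have "failures (n - e + k) {} R' = 0"
      using fills_iff_parking_function[OF lenR'] R'_range full \<open>s \<le> n\<close> by fastforce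
    then have "R' \<in> flaw_sets (n + k - e) (n + k - e) (s - e) 0"
      using lenR' R'_range e \<open>s \<le> n\<close>
      by (fastforce simp: flaw_sets_def preference_sets_def)
    ultimately show "k \<le> e \<and> e < s \<and> L \<in> flaw_sets (e - k) (e - 1) (e - 1) 0 \<and>
      R \<in> map (\<lambda>a. a + e) ` flaw_sets (n + k - e) (n + k - e) (s - e) 0"
      using R_eq[OF e'(1)] \<open>e < s\<close> by blast
  next
    assume *: "k \<le> e \<and> e < s \<and> L \<in> flaw_sets (e - k) (e - 1) (e - 1) 0 \<and>
      R \<in> map (\<lambda>a. a + e) ` flaw_sets (n + k - e) (n + k - e) (s - e) 0"
    then have ke: "k \<le> e" "e < s"
      and L: "length L = e - k" "\<forall>a\<in>set L. 1 \<le> a \<and> a \<le> e - 1" "failures (e - 1) {} L = 0"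
      by (auto simp: flaw_sets_def preference_sets_def)
    from * obtain T where T: "R = map (\<lambda>a. a + e) T" "length T = n - e + k"
      "\<forall>a\<in>set T. 1 \<le> a \<and> a \<le> s - e" "failures (n - e + k) {} T = 0"
      using ke \<open>s \<le> n\<close> by (auto simp: flaw_sets_def preference_sets_def)
    have set_as: "set as = set L \<union> set R" unfolding L_def R_def by auto
    \<comment> \<open>Entries of \<open>L\<close> are at most \<open>e - 1\<close>, and those of
      \<open>R\<close> are at least \<open>e + 1\<close> because entries of \<open>T\<close> are
      positive.\<close>
    have "e \<notin> set as"
      using L T unfolding set_as by fastforce
    with R_eq T(1) have "map (\<lambda>a. a + e) T = map (\<lambda>a. a + e) R'" by simp
    then have "T = R'" by (simp add: inj_map_eq_map inj_def)
    have split': "e \<notin> occupied n {} as" "failures n {} as = failures (n - e) {} R'"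
      "{x. 1 \<le> x \<and> x + e \<in> occupied n {} as} = occupied (n - e) {} R'"
      using split L \<open>e \<notin> set as\<close> ke \<open>s \<le> n\<close> by auto
    have full: "occupied (n - e) {} R' = {1..n - e}"
      using fills_iff_parking_function[OF T(2)] T ke \<open>s \<le> n\<close> \<open>T = R'\<close> by fastforce
    have "failures (n - e) {} R' = k"
      using failures_plus_card_occupied[of "{}" "n - e" R'] full T \<open>T = R'\<close> by simp
    moreover have "length as = n" using len L T ke \<open>s \<le> n\<close> by simp
    moreover have "\<forall>a\<in>set as. 1 \<le> a \<and> a \<le> s"
      using L T ke unfolding set_as by fastforce
    ultimately have "as \<in> flaw_sets n n s k"
      using split' \<open>s \<le> n\<close> by (fastforce simp: flaw_sets_def preference_sets_def)
    moreover have "x \<in> occupied n {} as" if "x \<in> {e<..n}" for x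
    proof -
      have "x - e \<in> {x. 1 \<le> x \<and> x + e \<in> occupied n {} as}"
        unfolding split'(3) full using that by auto
      then show ?thesis using that by simp
    qed
    ultimately show "as \<in> flaw_sets n n s k \<and> last_empty n as e"
      using split' ke \<open>k \<ge> 1\<close> \<open>s \<le> n\<close> by (auto simp: last_empty_def)
  }
qed

section \<open>Counting shuffles\<close>

text \<open>A list with given parts is exactly a shuffle of them. The parts share no entries, so the
  number of shuffles is a binomial coefficient that depends on the lengths alone.\<close>

lemma card_filter_split:
  assumes "finite X" "finite Y"
    and X: "\<And>xs. xs \<in> X \<Longrightarrow> length xs = l \<and> (\<forall>x\<in>set xs. P x)"
    and Y: "\<And>ys. ys \<in> Y \<Longrightarrow> length ys = r \<and> (\<forall>y\<in>set ys. \<not> P y)"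
  shows "card {zs. filter P zs \<in> X \<and> filter (\<lambda>x. \<not> P x) zs \<in> Y} =
    ((l + r) choose l) * card Y * card X"
proof -
  have filt: "filter P zs = xs" "filter (\<lambda>x. \<not> P x) zs = ys"
    if "xs \<in> X" "ys \<in> Y" "zs \<in> shuffles xs ys" for xs ys zs
  proof -
    \<comment> \<open>Filtering commutes with shuffling, and shuffling with the empty list changes
      nothing, so each filter recovers its own part. This later makes the shuffle sets of distinct
      pairs disjoint.\<close>
    have "filter P zs \<in> filter P ` shuffles xs ys"
      "filter (\<lambda>x. \<not> P x) zs \<in> filter (\<lambda>x. \<not> P x) ` shuffles xs ys"
      using that by auto
    moreover have "filter P xs = xs" "filter P ys = []"
      "filter (\<lambda>x. \<not> P x) xs = []" "filter (\<lambda>x. \<not> P x) ys = ys"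
      using X[OF that(1)] Y[OF that(2)] by (auto simp: filter_id_conv filter_empty_conv)
    ultimately show "filter P zs = xs" "filter (\<lambda>x. \<not> P x) zs = ys"
      by (simp_all add: filter_shuffles)
  qed
  have "{zs. filter P zs \<in> X \<and> filter (\<lambda>x. \<not> P x) zs \<in> Y} =
    (\<Union>(xs, ys)\<in>X \<times> Y. shuffles xs ys)"
  proof (intro equalityI subsetI)
    fix zs assume "zs \<in> {zs. filter P zs \<in> X \<and> filter (\<lambda>x. \<not> P x) zs \<in> Y}"
    then show "zs \<in> (\<Union>(xs, ys)\<in>X \<times> Y. shuffles xs ys)"
      using partition_in_shuffles[of zs P] by blast
  qed (clarsimp simp: filt)
  also have "card \<dots> = (\<Sum>(xs, ys)\<in>X \<times> Y. card (shuffles xs ys))"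
  proof (subst card_UN_disjoint)
    show "\<forall>p\<in>X \<times> Y. \<forall>q\<in>X \<times> Y. p \<noteq> q \<longrightarrow>
      (case p of (xs, ys) \<Rightarrow> shuffles xs ys) \<inter> (case q of (xs, ys) \<Rightarrow> shuffles xs ys) = {}"
      using filt by (clarsimp simp: disjoint_iff) metis
  qed (use assms in \<open>auto simp: case_prod_beta\<close>)
  also have "\<dots> = (\<Sum>(xs, ys)\<in>X \<times> Y. (l + r) choose l)"
  proof (intro sum.cong refl, clarify)
    fix xs ys assume "xs \<in> X" "ys \<in> Y"
    then show "card (shuffles xs ys) = (l + r) choose l"
      using X[of xs] Y[of ys] card_disjoint_shuffles[of xs ys] by auto
  qed
  finally show ?thesis by (simp add: card_cartesian_product)
qed

section \<open>Summation over the last empty space\<close>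

lemma finite_flaw_sets: "finite (flaw_sets n m s k)"
proof (rule finite_subset)
  show "flaw_sets n m s k \<subseteq> {as. set as \<subseteq> {1..m} \<and> length as = n}"
    by (auto simp: flaw_sets_def preference_sets_def)
qed (simp add: finite_lists_length_eq)

text \<open>Passing to tails sets the first car aside, so that only the other cars are
  shuffled.\<close>

lemma flaw_count_first_eq_card_tails:
  "flaw_count_first l n m s k = card {as. l # as \<in> flaw_sets n m s k}"
proof -
  have "{as \<in> flaw_sets n m s k. as \<noteq> [] \<and> hd as = l} =
    (\<lambda>as. l # as) ` {as. l # as \<in> flaw_sets n m s k}"
    by (auto simp: image_iff neq_Nil_conv)
  then show ?thesis
    unfolding flaw_count_first_def by (simp add: card_image inj_on_def)
qed

lemma finite_flaw_tails: "finite {as. l # as \<in> flaw_sets n m s k}"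
proof -
  have "finite ((\<lambda>as. l # as) -` flaw_sets n m s k)"
    by (intro finite_vimageI finite_flaw_sets) (simp add: inj_on_def)
  then show ?thesis by (simp add: vimage_def)
qed

text \<open>The first car is always a left car, as \<open>1 < e\<close>. Among the other
  \<open>n - 1\<close> cars, \<open>e - k - 1\<close> are on the left, whence the binomial
  coefficient.\<close>

lemma card_flaw_tails_last_empty:
  assumes "k \<ge> 1" "s \<le> n" "k + 1 \<le> e" "e < s"
  shows "card {as. 1 # as \<in> flaw_sets n n s k \<and> last_empty n (1 # as) e} =
    ((n - 1) choose (e - k - 1)) * flaw_count (n + k - e) (n + k - e) (s - e) 0
      * flaw_count_first 1 (e - k) (e - 1) (e - 1) 0"
proof -
  define X where "X = {xs. 1 # xs \<in> flaw_sets (e - k) (e - 1) (e - 1) 0}"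
  define Y where "Y = map (\<lambda>a. a + e) ` flaw_sets (n + k - e) (n + k - e) (s - e) 0"
  \<comment> \<open>As \<open>1 < e\<close>, the left filter keeps the leading 1, which
    \<open>X\<close> absorbs, and the complementary filter drops it.\<close>
  have eq: "1 # as \<in> flaw_sets n n s k \<and> last_empty n (1 # as) e \<longleftrightarrow>
    filter (\<lambda>a. a < e) as \<in> X \<and> filter (\<lambda>a. \<not> a < e) as \<in> Y" for as
    using last_empty_flaw_iff[of k s n "1 # as" e] assms by (auto simp: X_def Y_def)
  have "card {as. filter (\<lambda>a. a < e) as \<in> X \<and> filter (\<lambda>a. \<not> a < e) as \<in> Y} =
    ((e - k - 1 + (n + k - e)) choose (e - k - 1)) * card Y * card X"
  proof (rule card_filter_split)
    show "finite X" unfolding X_def by (rule finite_flaw_tails)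
    show "finite Y" unfolding Y_def by (intro finite_imageI finite_flaw_sets)
    show "length xs = e - k - 1 \<and> (\<forall>x\<in>set xs. x < e)" if "xs \<in> X" for xs
      using that assms by (fastforce simp: X_def flaw_sets_def preference_sets_def)
    show "length ys = n + k - e \<and> (\<forall>y\<in>set ys. \<not> y < e)" if "ys \<in> Y" for ys
      using that by (auto simp: Y_def flaw_sets_def preference_sets_def)
  qed
  moreover have "e - k - 1 + (n + k - e) = n - 1" using assms by simp
  moreover have "card Y = flaw_count (n + k - e) (n + k - e) (s - e) 0"
    unfolding Y_def flaw_count_def
    by (rule card_image) (simp add: inj_on_def inj_map_eq_map inj_def)
  moreover have "card X = flaw_count_first 1 (e - k) (e - 1) (e - 1) 0"
    unfolding X_def by (rule flaw_count_first_eq_card_tails[symmetric])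
  ultimately show ?thesis unfolding eq by simp
qed

theorem theorem6p2:
  fixes n s k :: nat
  assumes "k \<ge> 1" and "k + 1 \<le> s" and "s \<le> n"
  shows "flaw_count_first 1 n n s k =
    (\<Sum>i = 1..s - k - 1.
       ((n - 1) choose (s - i - k - 1))
       * flaw_count (n + k - s + i) (n + k - s + i) i 0
       * flaw_count_first 1 (s - k - i) (s - i - 1) (s - i - 1) 0)"
proof -
  define A where "A e = {as. 1 # as \<in> flaw_sets n n s k \<and> last_empty n (1 # as) e}" for e
  have "{as. 1 # as \<in> flaw_sets n n s k} = (\<Union>e\<in>{k + 1..<s}. A e)"
  proof (intro equalityI subsetI)
    fix as assume "as \<in> {as. 1 # as \<in> flaw_sets n n s k}"
    then have as: "1 # as \<in> flaw_sets n n s k" by simp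
    then have range: "length (1 # as) = n" "\<forall>a\<in>set (1 # as). 1 \<le> a" "failures n {} (1 # as) = k"
      by (auto simp: flaw_sets_def preference_sets_def)
    then obtain e where e: "last_empty n (1 # as) e"
      using ex_last_empty[of "1 # as" n] assms by auto
    then have "1 \<le> e" by (simp add: last_empty_def)
    then have split: "e < s" "filter (\<lambda>a. a < e) (1 # as) \<in> flaw_sets (e - k) (e - 1) (e - 1) 0"
      using last_empty_flaw_iff[of k s n "1 # as" e] as e assms by auto
    \<comment> \<open>The first car prefers 1, and a preferred space cannot stay empty. Hence this
      car is on the left, and the left length \<open>e - k\<close> is positive.\<close>
    have "e \<noteq> 1"
      using e empty_space_splits[of e n "{}" "1 # as"] by (auto simp: last_empty_def)
    then have "k + 1 \<le> e"
      using split \<open>1 \<le> e\<close> by (auto simp: flaw_sets_def preference_sets_def)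
    with split as e show "as \<in> (\<Union>e\<in>{k + 1..<s}. A e)" by (auto simp: A_def)
  qed (auto simp: A_def)
  then have "flaw_count_first 1 n n s k = card (\<Union>e\<in>{k + 1..<s}. A e)"
    by (simp add: flaw_count_first_eq_card_tails)
  also have "\<dots> = (\<Sum>e\<in>{k + 1..<s}. card (A e))"
  proof (intro card_UN_disjoint ballI impI)
    show "finite (A e)" for e
      unfolding A_def by (rule finite_subset[OF _ finite_flaw_tails]) auto
    show "A e \<inter> A e' = {}" if "e \<noteq> e'" for e e'
      using that last_empty_unique by (auto simp: A_def)
  qed simp
  also have "\<dots> = (\<Sum>e\<in>{k + 1..<s}.
      ((n - 1) choose (e - k - 1)) * flaw_count (n + k - e) (n + k - e) (s - e) 0
        * flaw_count_first 1 (e - k) (e - 1) (e - 1) 0)"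
    unfolding A_def using assms by (intro sum.cong refl card_flaw_tails_last_empty) auto
  \<comment> \<open>The index becomes \<open>i = s - e\<close>, the bound on the shifted right
    preferences; \<open>e < s\<close> keeps the natural-number subtractions exact.\<close>
  also have "\<dots> = (\<Sum>i = 1..s - k - 1.
       ((n - 1) choose (s - i - k - 1))
       * flaw_count (n + k - s + i) (n + k - s + i) i 0
       * flaw_count_first 1 (s - k - i) (s - i - 1) (s - i - 1) 0)"
  proof (rule sum.reindex_bij_witness[of _ "\<lambda>i. s - i" "\<lambda>e. s - e"])
    fix e assume e: "e \<in> {k + 1..<s}"
    then have "s - (s - e) = e" "n + k - s + (s - e) = n + k - e" "s - k - (s - e) = e - k"
      using assms by auto
    then show "((n - 1) choose (s - (s - e) - k - 1))
       * flaw_count (n + k - s + (s - e)) (n + k - s + (s - e)) (s - e) 0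
       * flaw_count_first 1 (s - k - (s - e)) (s - (s - e) - 1) (s - (s - e) - 1) 0 =
      ((n - 1) choose (e - k - 1)) * flaw_count (n + k - e) (n + k - e) (s - e) 0
        * flaw_count_first 1 (e - k) (e - 1) (e - 1) 0"
      by simp
  qed auto
  finally show ?thesis .
qed

end
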